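(* Let $N\ge 2$, $K\ge 1$ and $m\ge 1$ be integers, let $\Theta=\{0,1\}^{K(N-1)}$ be the set of assignments of customer ports to ships, and let $h:\Theta\to\mathbb{R}$ be the total optimized profit function (defined in the context). Let $\Phi\subseteq\Theta$ be the set of local optima of $h$, i.e. the set of $Y\in\Theta$ such that $h(Y)\ge h(Z)$ for all $Z\in\Theta$ differing from $Y$ in exactly one digit. Let $\{Y_0^*,Y_1^*,Y_2^*,\dots\}$ be the infinite sequence of current best solutions generated by the Most Promising Area search algorithm (defined in the context) run indefinitely with $m$ samples per iteration. Then the sequence converges with probability 1 to the set $\Phi$, in the sense that $$P\{\,Y_r^*\in\Phi \text{ for infinitely many } r\,\}=1 .$$
   Context: **Distance, neighborhoods, local optima.** For $Y_1,Y_2\in\Theta=\{0,1\}^{K(N-1)}$, $dist(Y_1,Y_2)$ is the number of indices $i$ with $Y_1(i)\ne Y_2(i)$. The neighborhood of $Y$ is $N(Y)=\{Z\in\Theta: dist(Y,Z)=1\}$. $Y$ is a local optimum if $h(Y)\ge h(Z)$ for all $Z\in N(Y)$. **Algorithm (Most Promising Area search).** - Initialization: choose an initial solution $Y_0\in\Theta$; set $R_0=\{Y_0\}$, $Y_0^*=Y_0$, $\zeta_0=\Theta$. - Iteration $r=1,2,3,\dots$: conditionally on the history up to iteration $r-1$, generate $Y_{r1},\dots,Y_{rm}$ independently and uniformly at random from $\zeta_{r-1}$. Set $R_r=R_{r-1}\cup\{Y_{r1},\dots,Y_{rm}\}$. Let $Y_r^*\in\operatorname{arg\,max}_{Y\in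 R_r}h(Y)$ (ties broken by some rule depending only on the history so far). Set the most promising area $$\zeta_r=\{Y\in\Theta:\ dist(Y,Y_r^* )\le dist(Y,Z)\ \text{ for all } Z\in R_r,\ Z\ne Y_r^*\}.$$ The algorithm is run without a stopping rule, so that an infinite sequence is produced. **The profit function $h$.** There are ports $1,\dots,N$ (port $1$ is the depot, ports $2,\dots,N$ are customers) and ships $1,\dots,K$. Write $Y=[y_1,\dots,y_K]$ with $y_k\in\{0,1\}^{N-1}$, whose digits indicate which customer ports are assigned to ship $k$. The ships are treated in the order $k=1,\dots,K$, starting with the real delivery and pickup demands $D_{i1},D_{i2}$ of the customer ports $i$. For ship $k$, let $S_k$ be its set of assigned customer ports. Solve the single-ship problem below for $S_k$ with the current remaining demands, giving optimal profit $p_k^*$ and optimal quantities $Q_{i1}^*,Q_{i2}^*$ (a fixed choice of optimal solution). If $p_k^*$ exceeds the chartering revenue $R^k$ of ship $k$, subtract $Q_{i1}^*,Q_{i2}^*$ from the remaining demands; otherwise (including the case where the problem is infeasible) the ship is chartered out, $p_k^*$ is set to $R^k$, and demands are unchanged. Finally $h(Y)=\sum_{k=1}^K p_k^*$. Thus $h$ is a fixed, deterministic real-valued function on $\Theta$. **Single-ship problem** (for one ship, superscript $k$ dropped). Relabel the depot as $1$, the assigned customer ports as $2,\dots,n$, and let $n+1$ be a virtual copy of the depot. Data: unit delivery and pickup revenues $r_{i1},r_{i2}$; remaining demands $D_{i1},D_{i2}$; lightweight $W_0$ and deadweight $W_{\max}$; weight $w$ per unit cargo; distances $d_{ij}$;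 port processing times $s_i$; time windows $[e_i,l_i]$; cycle time limit $T$; maximum fuel volume $I_{\max}$; minimum bunkering fraction $e$; safety fuel fraction $c$; fuel consumption per unit distance $g(W,t)=C\,W/t^2$ with $C$ a constant of the ship; fuel cost function $f_i$ of port $i$ given by $$f_i(B)=\begin{cases}p_i^1B,& B\in[0,v_1],\\ p_i^1v_1+p_i^2(B-v_1),& B\in[v_1,v_2],\\ p_i^1v_1+p_i^2(v_2-v_1)+p_i^3(B-v_2),& B\in[v_2,v_3].\end{cases}$$ Variables: delivered and picked-up quantities $Q_{i1},Q_{i2}\ge0$ ($2\le i\le n$); routing $x_{ij}\in\{0,1\}$ ($1\le i\le n$, $2\le j\le n+1$, $i\ne j$); travel time per unit distance $t_{ij}$; bunkering volumes $B_i$ and bunkering indicators $b_i\in\{0,1\}$ ($1\le i\le n$); fuel levels $I_i$ on entering port $i$; displacements $W_i$ on leaving port $i$; arrival times $a_i$. Maximize $$\sum_{i=2}^n(r_{i1}Q_{i1}+r_{i2}Q_{i2})-\sum_{i=1}^nf_i(B_i)$$ subject to: - $Q_{i1}\le D_{i1}$, $Q_{i2}\le D_{i2}$ for $2\le i\le n$; - $\sum_{j\ne i}x_{ij}=1$ for $1\le i\le n$, and $\sum_{j\ne i}x_{ji}=1$ for $2\le i\le n+1$; - $W_1=W_0+w\sum_{i=2}^nQ_{i1}$, and $W_i\le W_{\max}$ for $1\le i\le n$; - $I_1=I_{n+1}$; $I_i\ge c\,I_{\max}$ for $1\le i\le n+1$; $I_i+B_i\le I_{\max}$ and $e\,I_{\max}b_i\le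 B_i\le I_{\max}b_i$ for $1\le i\le n$; - $a_1=0$; $e_i\le a_i\le l_i$ for $2\le i\le n$; $a_{n+1}\le T$; - whenever $x_{ij}=1$: $W_j=W_i+w(Q_{j2}-Q_{j1})$ (with $Q_{n+1,1}=Q_{n+1,2}=0$), $I_j=I_i+B_i-d_{ij}\,g(W_i,t_{ij})$, and $a_j=a_i+d_{ij}t_{ij}+s_i$. *)

theory Defs
  imports "HOL-Probability.Probability"
begin

section \<open>The single-ship problem\<close>

text \<open>
  Ports are numbered \<open>1, \<dots>, N\<close>, port \<open>1\<close> being the depot. The ports of a single-ship problem are
  not relabelled: its nodes are the depot \<open>1\<close>, the set \<open>S\<close> of assigned customer ports (a subset of
  \<open>{2..N}\<close>), and the virtual copy \<open>N + 1\<close> of the depot. Hence the index range \<open>1, \<dots>, n\<close> is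
  \<open>insert 1 S\<close>, the range \<open>2, \<dots>, n\<close> is \<open>S\<close>, and the range \<open>2, \<dots>, n + 1\<close> is \<open>insert (N + 1) S\<close>.

  The demands of a port are the pair of its delivery and its pickup demand. All other data may
  depend on the ship.
\<close>

type_synonym demands = "nat \<Rightarrow> real \<times> real"

record ship_data =
  charter_rev :: real
  rev_deliv :: "nat \<Rightarrow> real"
  rev_pick :: "nat \<Rightarrow> real"
  lightweight :: real
  deadweight :: real
  unit_weight :: real
  distance :: "nat \<Rightarrow> nat \<Rightarrow> real"
  proc_time :: "nat \<Rightarrow> real"
  tw_open :: "nat \<Rightarrow> real"
  tw_close :: "nat \<Rightarrow> real"
  cycle_limit :: real
  fuel_max :: real
  min_bunker_frac :: real
  safety_frac :: real
  fuel_const :: real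
  price1 :: "nat \<Rightarrow> real"
  price2 :: "nat \<Rightarrow> real"
  price3 :: "nat \<Rightarrow> real"
  break1 :: real
  break2 :: real
  break3 :: real

record plan =
  Qd :: "nat \<Rightarrow> real"
  Qp :: "nat \<Rightarrow> real"
  route :: "nat \<Rightarrow> nat \<Rightarrow> real"
  unit_time :: "nat \<Rightarrow> nat \<Rightarrow> real"
  bunker :: "nat \<Rightarrow> real"
  bunker_ind :: "nat \<Rightarrow> real"
  fuel :: "nat \<Rightarrow> real"
  displ :: "nat \<Rightarrow> real"
  arrival :: "nat \<Rightarrow> real"

definition fuel_rate :: "ship_data \<Rightarrow> real \<Rightarrow> real \<Rightarrow> real" where
  "fuel_rate sd W t = fuel_const sd * W / t\<^sup>2"

text \<open>Only meant for \<open>B \<in> {0..break3 sd}\<close>, a range that \<open>feasible\<close> enforces below.\<close>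

definition fuel_cost :: "ship_data \<Rightarrow> nat \<Rightarrow> real \<Rightarrow> real" where
  "fuel_cost sd i B =
    (if B \<le> break1 sd then price1 sd i * B
     else if B \<le> break2 sd then price1 sd i * break1 sd + price2 sd i * (B - break1 sd)
     else price1 sd i * break1 sd + price2 sd i * (break2 sd - break1 sd)
          + price3 sd i * (B - break2 sd))"

definition node_distance :: "nat \<Rightarrow> ship_data \<Rightarrow> nat \<Rightarrow> nat \<Rightarrow> real" where
  "node_distance N sd i j = distance sd i (if j = N + 1 then 1 else j)"

text \<open>
  The conditions \<open>unit_time p i j > 0\<close> and \<open>bunker p i \<in> {0..break3 sd}\<close> make the domains of
  the fuel consumption and fuel cost functions explicit. The former also matters because
  \<open>x / 0 = 0\<close> would make sailing in time \<open>0\<close> free of fuel.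
\<close>

definition feasible :: "nat \<Rightarrow> ship_data \<Rightarrow> nat set \<Rightarrow> demands \<Rightarrow> plan \<Rightarrow> bool" where
  "feasible N sd S D p \<longleftrightarrow>
    (\<forall>i\<in>S. 0 \<le> Qd p i \<and> Qd p i \<le> fst (D i) \<and> 0 \<le> Qp p i \<and> Qp p i \<le> snd (D i)) \<and>
    Qd p (N + 1) = 0 \<and> Qp p (N + 1) = 0 \<and>
    (\<forall>i\<in>insert 1 S. \<forall>j\<in>insert (N + 1) S - {i}. route p i j \<in> {0, 1} \<and> unit_time p i j > 0) \<and>
    (\<forall>i\<in>insert 1 S. (\<Sum>j\<in>insert (N + 1) S - {i}. route p i j) = 1) \<and>
    (\<forall>i\<in>insert (N + 1) S. (\<Sum>j\<in>insert 1 S - {i}. route p j i) = 1) \<and>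
    displ p 1 = lightweight sd + unit_weight sd * (\<Sum>i\<in>S. Qd p i) \<and>
    (\<forall>i\<in>insert 1 S. displ p i \<le> deadweight sd) \<and>
    fuel p 1 = fuel p (N + 1) \<and>
    (\<forall>i\<in>insert 1 (insert (N + 1) S). safety_frac sd * fuel_max sd \<le> fuel p i) \<and>
    (\<forall>i\<in>insert 1 S.
      fuel p i + bunker p i \<le> fuel_max sd \<and>
      bunker_ind p i \<in> {0, 1} \<and>
      min_bunker_frac sd * fuel_max sd * bunker_ind p i \<le> bunker p i \<and>
      bunker p i \<le> fuel_max sd * bunker_ind p i \<and>
      bunker p i \<in> {0..break3 sd}) \<and>
    arrival p 1 = 0 \<and>
    (\<forall>i\<in>S. tw_open sd i \<le> arrival p i \<and> arrival p i \<le> tw_close sd i) \<and>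
    arrival p (N + 1) \<le> cycle_limit sd \<and>
    (\<forall>i\<in>insert 1 S. \<forall>j\<in>insert (N + 1) S - {i}. route p i j = 1 \<longrightarrow>
      displ p j = displ p i + unit_weight sd * (Qp p j - Qd p j) \<and>
      fuel p j = fuel p i + bunker p i
                 - node_distance N sd i j * fuel_rate sd (displ p i) (unit_time p i j) \<and>
      arrival p j = arrival p i + node_distance N sd i j * unit_time p i j + proc_time sd i)"

definition plan_profit :: "ship_data \<Rightarrow> nat set \<Rightarrow> plan \<Rightarrow> real" where
  "plan_profit sd S p =
    (\<Sum>i\<in>S. rev_deliv sd i * Qd p i + rev_pick sd i * Qp p i)
    - (\<Sum>i\<in>insert 1 S. fuel_cost sd i (bunker p i))"

definition optimal_plan :: "nat \<Rightarrow> ship_data \<Rightarrow> nat set \<Rightarrow> demands \<Rightarrow> plan \<Rightarrow> bool" where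
  "optimal_plan N sd S D p \<longleftrightarrow> is_arg_max (plan_profit sd S) (feasible N sd S D) p"


section \<open>The solution space and the profit function\<close>

definition solutions :: "nat \<Rightarrow> nat \<Rightarrow> bool list set" where
  "solutions N K = {Y. length Y = K * (N - 1)}"

text \<open>
  The \<open>k\<close>-th block of \<open>N - 1\<close> digits belongs to ship \<open>k\<close>; its digits stand for the customer
  ports \<open>2, \<dots>, N\<close> in this order.
\<close>

definition assigned :: "nat \<Rightarrow> bool list \<Rightarrow> nat \<Rightarrow> nat set" where
  "assigned N Y k = {i \<in> {2..N}. Y ! ((k - 1) * (N - 1) + (i - 2))}"

text \<open>
  The fixed choice of optimal solutions is a function \<open>sel\<close> of the ship, the assigned ports and
  the remaining demands.
\<close>

definition optimal_choice ::
  "nat \<Rightarrow> nat \<Rightarrow> (nat \<Rightarrow> ship_data) \<Rightarrow> (nat \<Rightarrow> nat set \<Rightarrow> demands \<Rightarrow> plan) \<Rightarrow> bool" where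
  "optimal_choice N K sd sel \<longleftrightarrow>
    (\<forall>k\<in>{1..K}. \<forall>S D. S \<subseteq> {2..N} \<longrightarrow> (\<exists>p. optimal_plan N (sd k) S D p) \<longrightarrow>
      optimal_plan N (sd k) S D (sel k S D))"

text \<open>
  A feasible problem is understood to have an optimal solution, so that the first conjunct below
  means feasibility. No such assumption is imposed; without an optimum the ship is chartered out.
\<close>

definition operates ::
  "nat \<Rightarrow> (nat \<Rightarrow> ship_data) \<Rightarrow> (nat \<Rightarrow> nat set \<Rightarrow> demands \<Rightarrow> plan) \<Rightarrow>
    nat \<Rightarrow> nat set \<Rightarrow> demands \<Rightarrow> bool" where
  "operates N sd sel k S D \<longleftrightarrow>
    (\<exists>p. optimal_plan N (sd k) S D p) \<and> plan_profit (sd k) S (sel k S D) > charter_rev (sd k)"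

text \<open>\<open>remaining N sd sel D Y k\<close> are the demands left after ships \<open>1, \<dots>, k\<close> have been treated.\<close>

primrec remaining ::
  "nat \<Rightarrow> (nat \<Rightarrow> ship_data) \<Rightarrow> (nat \<Rightarrow> nat set \<Rightarrow> demands \<Rightarrow> plan) \<Rightarrow> demands \<Rightarrow>
    bool list \<Rightarrow> nat \<Rightarrow> demands" where
  "remaining N sd sel D Y 0 = D"
| "remaining N sd sel D Y (Suc k) =
    (let D' = remaining N sd sel D Y k; S = assigned N Y (Suc k); p = sel (Suc k) S D' in
      if operates N sd sel (Suc k) S D'
      then (\<lambda>i. if i \<in> S then (fst (D' i) - Qd p i, snd (D' i) - Qp p i) else D' i)
      else D')"

definition ship_profit ::
  "nat \<Rightarrow> (nat \<Rightarrow> ship_data) \<Rightarrow> (nat \<Rightarrow> nat set \<Rightarrow> demands \<Rightarrow> plan) \<Rightarrow> demands \<Rightarrow>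
    bool list \<Rightarrow> nat \<Rightarrow> real" where
  "ship_profit N sd sel D Y k =
    (let D' = remaining N sd sel D Y (k - 1); S = assigned N Y k in
      if operates N sd sel k S D' then plan_profit (sd k) S (sel k S D') else charter_rev (sd k))"

definition total_profit ::
  "nat \<Rightarrow> nat \<Rightarrow> (nat \<Rightarrow> ship_data) \<Rightarrow> (nat \<Rightarrow> nat set \<Rightarrow> demands \<Rightarrow> plan) \<Rightarrow> demands \<Rightarrow>
    bool list \<Rightarrow> real" where
  "total_profit N K sd sel D Y = (\<Sum>k=1..K. ship_profit N sd sel D Y k)"


section \<open>Local optima\<close>

definition hdist :: "bool list \<Rightarrow> bool list \<Rightarrow> nat" where
  "hdist Y Z = card {i. i < length Y \<and> Y ! i \<noteq> Z ! i}"

definition neighborhood :: "nat \<Rightarrow> nat \<Rightarrow> bool list \<Rightarrow> bool list set" where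
  "neighborhood N K Y = {Z \<in> solutions N K. hdist Y Z = 1}"

definition local_optima :: "nat \<Rightarrow> nat \<Rightarrow> (bool list \<Rightarrow> real) \<Rightarrow> bool list set" where
  "local_optima N K h = {Y \<in> solutions N K. \<forall>Z\<in>neighborhood N K Y. h Y \<ge> h Z}"


section \<open>Most Promising Area search\<close>

text \<open>
  A history up to iteration \<open>r\<close> consists of the initial solution and the list of the \<open>r\<close> batches
  of \<open>m\<close> samples drawn in iterations \<open>1, \<dots>, r\<close>. The tie-breaking rule is a function \<open>best\<close> that
  maps every history to the current best solution.
\<close>

type_synonym history = "bool list \<times> bool list list list"

definition histories :: "nat \<Rightarrow> nat \<Rightarrow> nat \<Rightarrow> history set" where
  "histories N K m = {(Y0, Ys). Y0 \<in> solutions N K \<and>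
    (\<forall>batch\<in>set Ys. length batch = m \<and> set batch \<subseteq> solutions N K)}"

definition visited :: "history \<Rightarrow> bool list set" where
  "visited H = {fst H} \<union> (\<Union>batch\<in>set (snd H). set batch)"

definition best_rule ::
  "nat \<Rightarrow> nat \<Rightarrow> nat \<Rightarrow> (bool list \<Rightarrow> real) \<Rightarrow> (history \<Rightarrow> bool list) \<Rightarrow> bool" where
  "best_rule N K m h best \<longleftrightarrow>
    (\<forall>H\<in>histories N K m. is_arg_max h (\<lambda>Y. Y \<in> visited H) (best H))"

definition promising_area ::
  "nat \<Rightarrow> nat \<Rightarrow> (history \<Rightarrow> bool list) \<Rightarrow> history \<Rightarrow> bool list set" where
  "promising_area N K best H =
    {Y \<in> solutions N K. \<forall>Z\<in>visited H. Z \<noteq> best H \<longrightarrow> hdist Y (best H) \<le> hdist Y Z}"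

text \<open>The initial values of the algorithm are instances of the general definitions.\<close>

lemma initial_best:
  assumes "best_rule N K m h best" "Y0 \<in> solutions N K"
  shows "best (Y0, []) = Y0"
proof -
  have "(Y0, []) \<in> histories N K m"
    using assms(2) by (simp add: histories_def)
  then show ?thesis
    using assms(1) by (fastforce simp: best_rule_def is_arg_max_def visited_def)
qed

lemma initial_promising_area:
  assumes "best_rule N K m h best" "Y0 \<in> solutions N K"
  shows "promising_area N K best (Y0, []) = solutions N K"
  using initial_best[OF assms] by (auto simp: promising_area_def visited_def)

definition history_at ::
  "nat \<Rightarrow> ('w \<Rightarrow> bool list) \<Rightarrow> (nat \<Rightarrow> nat \<Rightarrow> 'w \<Rightarrow> bool list) \<Rightarrow> nat \<Rightarrow> 'w \<Rightarrow> history" where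
  "history_at m Y0 Y r \<omega> = (Y0 \<omega>, map (\<lambda>q. map (\<lambda>i. Y q i \<omega>) [1..<m + 1]) [1..<r + 1])"

text \<open>
  \<open>Y r i\<close> is the \<open>i\<close>-th sample of iteration \<open>r\<close>. The initial solution \<open>Y0\<close> may be random; a fixed
  initial solution is the special case of a constant function.
\<close>

definition mpa_search ::
  "nat \<Rightarrow> nat \<Rightarrow> nat \<Rightarrow> (bool list \<Rightarrow> real) \<Rightarrow> (history \<Rightarrow> bool list) \<Rightarrow> 'w measure \<Rightarrow>
    ('w \<Rightarrow> bool list) \<Rightarrow> (nat \<Rightarrow> nat \<Rightarrow> 'w \<Rightarrow> bool list) \<Rightarrow> bool" where
  "mpa_search N K m h best M Y0 Y \<longleftrightarrow>
    best_rule N K m h best \<and>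
    Y0 \<in> measurable M (count_space (solutions N K)) \<and>
    (\<forall>r\<ge>1. \<forall>i\<in>{1..m}. Y r i \<in> measurable M (count_space (solutions N K))) \<and>
    (\<forall>r\<ge>1. \<forall>H z. \<P>(\<omega> in M. history_at m Y0 Y (r - 1) \<omega> = H) > 0 \<longrightarrow>
      \<P>(\<omega> in M. (\<forall>i\<in>{1..m}. Y r i \<omega> = z i) \<bar> history_at m Y0 Y (r - 1) \<omega> = H)
        = (\<Prod>i=1..m. pmf (pmf_of_set (promising_area N K best H)) (z i)))"

definition current_best ::
  "nat \<Rightarrow> (history \<Rightarrow> bool list) \<Rightarrow> ('w \<Rightarrow> bool list) \<Rightarrow> (nat \<Rightarrow> nat \<Rightarrow> 'w \<Rightarrow> bool list) \<Rightarrow>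
    nat \<Rightarrow> 'w \<Rightarrow> bool list" where
  "current_best m best Y0 Y r \<omega> = best (history_at m Y0 Y r \<omega>)"

end

theory Submission
  imports Defs
begin

text \<open>
  If the current best solution is not a local optimum, it has a strictly better neighbor. That
  neighbor has not been visited, so its distance to every visited point is at least \<open>1\<close>, its
  distance to the current best; hence it lies in the promising area, and a whole batch equals it
  with conditional probability at least \<open>|\<Theta>|\<^sup>-\<^sup>m\<close>. Such a batch enlarges the set of
  visited solutions, which happens at most \<open>|\<Theta>|\<close> times. So the probabilities that the current
  best is not a local optimum are summable, and the Borel--Cantelli lemma applies.
\<close>

section \<open>Solutions, Hamming distance and visited points\<close>

lemma finite_solutions: "finite (solutions N K)"
  using finite_lists_length_eq[of "UNIV :: bool set" "K * (N - 1)"]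
  by (simp add: solutions_def)

text \<open>\<open>hdist\<close> inspects only the positions below the length of its first argument,
  so symmetry hinges on equal lengths.\<close>

lemma hdist_commute: "length Y = length Z \<Longrightarrow> hdist Y Z = hdist Z Y"
  by (auto simp: hdist_def intro: arg_cong[where f = card])

lemma hdist_pos: "length Y = length Z \<Longrightarrow> Y \<noteq> Z \<Longrightarrow> 1 \<le> hdist Y Z"
  by (auto simp: hdist_def list_eq_iff_nth_eq card_gt_0_iff Suc_le_eq)

lemma visited_subset_solutions:
  "H \<in> histories N K m \<Longrightarrow> visited H \<subseteq> solutions N K"
  by (auto simp: histories_def visited_def)

lemma visited_append: "visited (Y, Ys @ [batch]) = visited (Y, Ys) \<union> set batch"
  by (auto simp: visited_def)

text \<open>Allows an event about iteration \<open>r\<close> to be split into finitely many pieces,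
  one for each possible history, on which the conditional law of the next batch is known.\<close>

lemma finite_histories:
  "finite {H \<in> histories N K m. length (snd H) = r}"
proof -
  let ?B = "{b. set b \<subseteq> solutions N K \<and> length b = m}"
  have "finite (solutions N K \<times> {Ys. set Ys \<subseteq> ?B \<and> length Ys = r})"
    by (intro finite_cartesian_product finite_lists_length_eq finite_solutions)
  then show ?thesis
    by (rule finite_subset[rotated]) (auto simp: histories_def)
qed

lemma promising_area_has_unvisited:
  assumes best: "best_rule N K m h best" and H: "H \<in> histories N K m"
    and not_opt: "best H \<notin> local_optima N K h"
  shows "\<exists>Z\<in>promising_area N K best H. Z \<notin> visited H"
proof -
  have arg_max: "is_arg_max h (\<lambda>Y. Y \<in> visited H) (best H)"
    using best H by (auto simp: best_rule_def)
  have sub: "visited H \<subseteq> solutions N K"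
    using H by (rule visited_subset_solutions)
  have "best H \<in> solutions N K"
    using arg_max sub by (auto simp: is_arg_max_def)
  then obtain Z where Z: "Z \<in> solutions N K" "hdist (best H) Z = 1" "h (best H) < h Z"
    using not_opt by (force simp: local_optima_def neighborhood_def not_le)
  have new: "Z \<notin> visited H"
    using arg_max Z(3) by (auto simp: is_arg_max_def)
  \<comment> \<open>\<open>neighborhood\<close> measures from the current best,
    \<open>promising_area\<close> from the candidate; symmetry reconciles the two.\<close>
  have "hdist Z (best H) = 1"
    using Z \<open>best H \<in> solutions N K\<close> hdist_commute[of Z "best H"] by (simp add: solutions_def)
  moreover have "1 \<le> hdist Z W" if "W \<in> visited H" for W
    using that new sub Z(1) by (intro hdist_pos) (auto simp: solutions_def)
  ultimately show ?thesis
    using Z(1) new by (auto simp: promising_area_def)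
qed

text \<open>The right-hand side is a pair ending in the newest batch, the shape that
  \<open>visited_append\<close> rewrites.\<close>

lemma history_at_Suc:
  "history_at m Y0 Y (Suc r) \<omega> =
    (Y0 \<omega>, snd (history_at m Y0 Y r \<omega>) @ [map (\<lambda>i. Y (Suc r) i \<omega>) [1..<m + 1]])"
  by (simp add: history_at_def)

lemma visited_history_at_Suc:
  "visited (history_at m Y0 Y (Suc r) \<omega>) =
    visited (history_at m Y0 Y r \<omega>) \<union> (\<lambda>i. Y (Suc r) i \<omega>) ` {1..m}"
proof -
  have "fst (history_at m Y0 Y r \<omega>) = Y0 \<omega>"
    by (simp add: history_at_def)
  moreover have "{Suc 0..<Suc m} = {1..m}"
    by auto
  ultimately show ?thesis
    by (subst history_at_Suc, subst visited_append) (simp add: visited_def del: upt_Suc)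
qed

section \<open>Borel--Cantelli with a bounded count, and measurability of lists\<close>

text \<open>The expected number of events \<open>B r\<close> that occur is at most \<open>C\<close>,
  so the probabilities of the \<open>A r\<close> sum to at most \<open>C / p\<close>; the first
  Borel--Cantelli lemma then applies, and no independence is involved.\<close>

lemma (in prob_space) borel_cantelli_bounded_count:
  assumes meas: "\<And>r. A r \<in> events" "\<And>r. B r \<in> events"
    and p: "0 < p" "\<And>r. p * prob (A r) \<le> prob (B r)"
    and count: "\<And>n \<omega>. \<omega> \<in> space M \<Longrightarrow> (\<Sum>r<n. indicator (B r) \<omega>) \<le> (C :: real)"
  shows "AE \<omega> in M. \<forall>\<^sub>F r in sequentially. \<omega> \<notin> A r"
proof -
  have "(\<Sum>r<n. prob (A r)) \<le> C / p" for n
  proof -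
    have "p * (\<Sum>r<n. prob (A r)) \<le> (\<Sum>r<n. prob (B r))"
      by (simp add: sum_distrib_left sum_mono p(2))
    also have "\<dots> = expectation (\<lambda>\<omega>. \<Sum>r<n. indicator (B r) \<omega>)"
      using meas(2) by (subst Bochner_Integration.integral_sum) (auto simp: emeasure_eq_measure)
    also have "\<dots> \<le> expectation (\<lambda>_. C)"
      using meas(2) count by (intro integral_mono) (auto simp: emeasure_eq_measure)
    finally show ?thesis
      using p(1) by (simp add: prob_space field_simps)
  qed
  then have "summable (\<lambda>r. prob (A r))"
    by (intro summableI_nonneg_bounded[where x = "C / p"]) auto
  then have "AE \<omega> in M. \<forall>\<^sub>F r in sequentially. \<omega> \<in> space M - A r"
    using meas(1) by (intro borel_cantelli_AE1) (auto simp: emeasure_eq_measure)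
  then show ?thesis
    by eventually_elim (simp add: eventually_conj_iff)
qed

text \<open>Used twice for histories: within a batch and across the batches. Values in a countable
  type make \<open>Cons\<close> of two measurable functions measurable.\<close>

lemma measurable_map_countable:
  fixes f :: "'i \<Rightarrow> 'a \<Rightarrow> 'b :: countable"
  assumes "\<And>i. i \<in> set xs \<Longrightarrow> f i \<in> measurable M (count_space UNIV)"
  shows "(\<lambda>\<omega>. map (\<lambda>i. f i \<omega>) xs) \<in> measurable M (count_space UNIV)"
  using assms
proof (induction xs)
  case (Cons x xs)
  have [measurable]: "f x \<in> measurable M (count_space UNIV)"
    "(\<lambda>\<omega>. map (\<lambda>i. f i \<omega>) xs) \<in> measurable M (count_space UNIV)"
    using Cons by auto
  show ?case
    by simp
qed simp

section \<open>Probability of a discovery during a run\<close>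

context prob_space
begin

context
  fixes N K m :: nat and h :: "bool list \<Rightarrow> real" and best :: "history \<Rightarrow> bool list"
    and Y0 :: "'a \<Rightarrow> bool list" and Y :: "nat \<Rightarrow> nat \<Rightarrow> 'a \<Rightarrow> bool list"
  assumes m_pos: "m \<ge> 1"
    and search: "mpa_search N K m h best M Y0 Y"
begin

private abbreviation "hist \<equiv> history_at m Y0 Y"

private abbreviation "stuck r \<equiv> {\<omega> \<in> space M. best (hist r \<omega>) \<notin> local_optima N K h}"

private abbreviation "discovers r \<equiv> {\<omega> \<in> space M. visited (hist r \<omega>) \<subset> visited (hist (Suc r) \<omega>)}"

lemma best_rule: "best_rule N K m h best"
  using search by (simp add: mpa_search_def)

lemma Y0_measurable: "Y0 \<in> measurable M (count_space (solutions N K))"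
  using search by (simp add: mpa_search_def)

lemma Y_measurable:
  "r \<ge> 1 \<Longrightarrow> i \<in> {1..m} \<Longrightarrow> Y r i \<in> measurable M (count_space (solutions N K))"
  using search by (simp add: mpa_search_def)

lemma Y0_measurable' [measurable]: "Y0 \<in> measurable M (count_space UNIV)"
  using Y0_measurable by (rule measurable_compose) simp

lemma Y_measurable':
  "r \<ge> 1 \<Longrightarrow> i \<in> {1..m} \<Longrightarrow> Y r i \<in> measurable M (count_space UNIV)"
  using Y_measurable by (rule measurable_compose) simp_all

lemma hist_measurable [measurable]: "hist r \<in> measurable M (count_space UNIV)"
proof -
  have [measurable]: "(\<lambda>\<omega>. map (\<lambda>q. map (\<lambda>i. Y q i \<omega>) [1..<m + 1]) [1..<r + 1])
      \<in> measurable M (count_space UNIV)"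
    by (intro measurable_map_countable Y_measurable') auto
  show ?thesis
    unfolding history_at_def by measurable
qed

lemma hist_in_histories: "\<omega> \<in> space M \<Longrightarrow> hist r \<omega> \<in> histories N K m"
  using measurable_space[OF Y0_measurable] measurable_space[OF Y_measurable]
  by (auto simp: history_at_def histories_def)

lemma length_hist: "length (snd (hist r \<omega>)) = r"
  by (simp add: history_at_def)

lemma discovers_event: "discovers r \<in> events"
proof -
  \<comment> \<open>The event compares two random histories: the earlier one is frozen at
    \<open>H\<close>, then its countably many values are recombined.\<close>
  have "Measurable.pred M (\<lambda>\<omega>. visited H \<subset> visited (hist (Suc r) \<omega>))" for H
    by (rule measurable_compose[OF hist_measurable]) simp
  then have "Measurable.pred M (\<lambda>\<omega>. visited (hist r \<omega>) \<subset> visited (hist (Suc r) \<omega>))"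
    by (rule measurable_compose_countable[OF _ hist_measurable])
  then show ?thesis
    by (simp add: pred_def)
qed

lemma batch_event: "{\<omega> \<in> space M. \<forall>i\<in>{1..m}. Y (Suc r) i \<omega> = Z} \<in> events"
proof -
  have "Measurable.pred M (\<lambda>\<omega>. Y (Suc r) i \<omega> = Z)" if "i \<in> {1..m}" for i
    using Y_measurable'[of "Suc r" i] that by measurable
  then show ?thesis
    by (intro sets.sets_Collect_finite_All) (auto simp: pred_def)
qed

text \<open>Given \<open>H\<close>, the batch is a product of uniform draws from the promising area,
  which has at most as many elements as \<open>solutions N K\<close>. The conditional law is
  prescribed only when \<open>H\<close> has positive probability; otherwise the left-hand side is
  \<open>0\<close>.\<close>

lemma prob_batch_ge:
  assumes Z: "Z \<in> promising_area N K best H"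
  shows "(1 / card (solutions N K)) ^ m * \<P>(\<omega> in M. hist r \<omega> = H)
    \<le> \<P>(\<omega> in M. (\<forall>i\<in>{1..m}. Y (Suc r) i \<omega> = Z) \<and> hist r \<omega> = H)"
proof (cases "\<P>(\<omega> in M. hist r \<omega> = H) > 0")
  case True
  let ?\<zeta> = "promising_area N K best H"
  have sub: "?\<zeta> \<subseteq> solutions N K"
    by (auto simp: promising_area_def)
  then have fin: "finite ?\<zeta>"
    using finite_solutions finite_subset by blast
  have card: "0 < card ?\<zeta>" "card ?\<zeta> \<le> card (solutions N K)"
    using Z fin sub by (auto simp: card_gt_0_iff intro: card_mono finite_solutions)
  have "(1 / real (card (solutions N K))) ^ m \<le> (1 / card ?\<zeta>) ^ m"
    using card by (intro power_mono divide_left_mono) auto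
  also have "\<dots> = (\<Prod>i=1..m. pmf (pmf_of_set ?\<zeta>) Z)"
    using Z fin by (subst pmf_of_set) auto
  also have "\<dots> = \<P>(\<omega> in M. (\<forall>i\<in>{1..m}. Y (Suc r) i \<omega> = Z) \<bar> hist r \<omega> = H)"
  proof -
    have "\<forall>r\<ge>1. \<forall>H z. \<P>(\<omega> in M. hist (r - 1) \<omega> = H) > 0 \<longrightarrow>
        \<P>(\<omega> in M. (\<forall>i\<in>{1..m}. Y r i \<omega> = z i) \<bar> hist (r - 1) \<omega> = H)
          = (\<Prod>i=1..m. pmf (pmf_of_set (promising_area N K best H)) (z i))"
      using search by (simp add: mpa_search_def)
    from this[rule_format, of "Suc r" H "\<lambda>_. Z"] show ?thesis
      using True by simp
  qed
  finally show ?thesis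
    using True by (simp add: cond_prob_def field_simps)
next
  case False
  then have "\<P>(\<omega> in M. hist r \<omega> = H) = 0"
    using measure_nonneg[of M "{\<omega> \<in> space M. hist r \<omega> = H}"] by linarith
  then show ?thesis
    by simp
qed

lemma prob_stuck_le:
  "(1 / card (solutions N K)) ^ m * prob (stuck r) \<le> prob (discovers r)"
proof -
  define p :: real where "p = (1 / card (solutions N K)) ^ m"
  define Hs where "Hs = {H \<in> histories N K m. length (snd H) = r \<and> best H \<notin> local_optima N K h}"
  have "finite Hs"
    by (rule finite_subset[OF _ finite_histories[of N K m r]]) (auto simp: Hs_def)
  have "\<forall>H\<in>Hs. \<exists>Z. Z \<in> promising_area N K best H \<and> Z \<notin> visited H"
    using promising_area_has_unvisited[OF best_rule] by (auto simp: Hs_def)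
  \<comment> \<open>The target \<open>Z H\<close> depends on the history alone, so it is a fixed
    point once \<open>hist r\<close> takes the value \<open>H\<close>.\<close>
  then obtain Z where Z: "\<And>H. H \<in> Hs \<Longrightarrow> Z H \<in> promising_area N K best H"
    "\<And>H. H \<in> Hs \<Longrightarrow> Z H \<notin> visited H"
    by metis
  define E where
    "E H = {\<omega> \<in> space M. (\<forall>i\<in>{1..m}. Y (Suc r) i \<omega> = Z H) \<and> hist r \<omega> = H}" for H
  have E_events: "E H \<in> events" for H
  proof -
    have "E H = {\<omega> \<in> space M. \<forall>i\<in>{1..m}. Y (Suc r) i \<omega> = Z H} \<inter> {\<omega> \<in> space M. hist r \<omega> = H}"
      by (auto simp: E_def)
    then show ?thesis
      using batch_event by simp
  qed
  \<comment> \<open>Being stuck is decided by the history up to iteration \<open>r\<close>; distinct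
    histories give disjoint events.\<close>
  have "stuck r = (\<Union>H\<in>Hs. {\<omega> \<in> space M. hist r \<omega> = H})"
    using hist_in_histories length_hist by (auto simp: Hs_def)
  then have "p * prob (stuck r) = (\<Sum>H\<in>Hs. p * \<P>(\<omega> in M. hist r \<omega> = H))"
    using \<open>finite Hs\<close>
    by (simp add: finite_measure_finite_Union disjoint_family_on_def sum_distrib_left image_subset_iff
        disjoint_iff)
  also have "\<dots> \<le> (\<Sum>H\<in>Hs. prob (E H))"
    unfolding E_def p_def by (intro sum_mono prob_batch_ge Z)
  also have "\<dots> = prob (\<Union>H\<in>Hs. E H)"
    using \<open>finite Hs\<close> E_events
    by (intro finite_measure_finite_Union[symmetric]) (auto simp: disjoint_family_on_def E_def)
  also have "\<dots> \<le> prob (discovers r)"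
  proof (rule finite_measure_mono[OF _ discovers_event])
    show "(\<Union>H\<in>Hs. E H) \<subseteq> discovers r"
      \<comment> \<open>\<open>m \<ge> 1\<close> makes the batch nonempty, so the unvisited
        \<open>Z H\<close> really enters the visited set.\<close>
      using Z(2) m_pos by (fastforce simp: E_def visited_history_at_Suc)
  qed
  finally show ?thesis
    unfolding p_def .
qed

lemma discoveries_bounded:
  assumes "\<omega> \<in> space M"
  shows "(\<Sum>r<n. indicator (discovers r) \<omega>) \<le> real (card (solutions N K))"
proof -
  have sub: "visited (hist r \<omega>) \<subseteq> solutions N K" for r
    using hist_in_histories[OF assms] by (rule visited_subset_solutions)
  then have fin: "finite (visited (hist r \<omega>))" for r
    using finite_solutions finite_subset by blast
  \<comment> \<open>The induction needs this sharper bound: each discovery adds at least one element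
    to the growing visited set.\<close>
  have "(\<Sum>r<n. indicator (discovers r) \<omega>) \<le> real (card (visited (hist n \<omega>)))"
  proof (induction n)
    case (Suc n)
    have "real (card (visited (hist n \<omega>))) + indicator (discovers n) \<omega>
        \<le> real (card (visited (hist (Suc n) \<omega>)))"
    proof (cases "\<omega> \<in> discovers n")
      case True
      then have "card (visited (hist n \<omega>)) < card (visited (hist (Suc n) \<omega>))"
        using fin by (auto intro: psubset_card_mono)
      then show ?thesis
        using True by simp
    next
      case False
      then show ?thesis
        using fin by (auto simp: visited_history_at_Suc intro: card_mono)
    qed
    then show ?case
      using Suc by simp
  qed simp
  also have "\<dots> \<le> card (solutions N K)"
    using sub finite_solutions by (simp add: card_mono)
  finally show ?thesis .
qed

section \<open>Almost sure convergence to the local optima\<close>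

lemma AE_eventually_local_optimum:
  "AE \<omega> in M. \<forall>\<^sub>F r in sequentially. best (hist r \<omega>) \<in> local_optima N K h"
proof -
  \<comment> \<open>Any solution would do: nonemptiness makes the lower bound \<open>p\<close> on
    the discovery probability positive.\<close>
  have "replicate (K * (N - 1)) False \<in> solutions N K"
    by (simp add: solutions_def)
  then have "0 < card (solutions N K)"
    using finite_solutions by (auto simp: card_gt_0_iff)
  then have "AE \<omega> in M. \<forall>\<^sub>F r in sequentially. \<omega> \<notin> stuck r"
    by (intro borel_cantelli_bounded_count[where p = "(1 / card (solutions N K)) ^ m"
          and B = discovers, OF _ discovers_event _ prob_stuck_le discoveries_bounded]) auto
  with AE_space show ?thesis
    by eventually_elim simp
qed

text \<open>Eventually always implies infinitely often along the naturals. Measurability of the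
  event turns the almost-everywhere statement into probability \<open>1\<close>.\<close>

lemma prob_infinitely_often_local_optimum:
  "\<P>(\<omega> in M. \<exists>\<^sub>\<infinity>r. current_best m best Y0 Y r \<omega> \<in> local_optima N K h) = 1"
proof -
  have "AE \<omega> in M. \<exists>\<^sub>\<infinity>r. current_best m best Y0 Y r \<omega> \<in> local_optima N K h"
    using AE_eventually_local_optimum
    by eventually_elim
      (simp add: current_best_def cofinite_eq_sequentially eventually_frequently)
  moreover have "{\<omega> \<in> space M. \<exists>\<^sub>\<infinity>r. current_best m best Y0 Y r \<omega> \<in> local_optima N K h} \<in> events"
    unfolding INFM_nat current_best_def by measurable
  ultimately show ?thesis
    by (simp add: prob_Collect_eq_1)
qed

end

end

theorem theorem1:
  fixes N K m :: nat
    and sd :: "nat \<Rightarrow> ship_data"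
    and sel :: "nat \<Rightarrow> nat set \<Rightarrow> demands \<Rightarrow> plan"
    and D :: demands
    and h :: "bool list \<Rightarrow> real"
    and best :: "history \<Rightarrow> bool list"
    and M :: "'w measure"
    and Y0 :: "'w \<Rightarrow> bool list"
    and Y :: "nat \<Rightarrow> nat \<Rightarrow> 'w \<Rightarrow> bool list"
  assumes "N \<ge> 2" and "K \<ge> 1" and "m \<ge> 1"
    and "optimal_choice N K sd sel"
    and "h = total_profit N K sd sel D"
    and "prob_space M"
    and "mpa_search N K m h best M Y0 Y"
  shows "\<P>(\<omega> in M. \<exists>\<^sub>\<infinity>r. current_best m best Y0 Y r \<omega> \<in> local_optima N K h) = 1"
  by (rule prob_space.prob_infinitely_often_local_optimum[OF assms(6,3,7)])

end
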